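(* Let $X$ be a path-connected space, $x_0\in X$, and $H\leq\pi_1(X,x_0)$ a subgroup. If $H$ is $(P,p_\tau)$-closed, then $H$ is $(C,c_\tau)$-closed.
   Context: A map is a continuous function; $f_{\#}$ denotes the homomorphism induced on fundamental groups. For paths, $\alpha\cdot\beta$ is concatenation and $\alpha^{-}(t)=\alpha(1-t)$. Closed subgroups: for a based space $(\mathbb{T},t_0)$, a subgroup $T\leq\pi_1(\mathbb{T},t_0)$ and $g\in\pi_1(\mathbb{T},t_0)$, a subgroup $H\leq\pi_1(X,x_0)$ is $(T,g)$-closed if for every map $f:(\mathbb{T},t_0)\to(X,x_0)$ with $f_{\#}(T)\leq H$ we have $f_{\#}(g)\in H$. The test space $\mathbb{H}^+$: let $C_n\subseteq\mathbb{R}^2$ be the circle of radius $\frac1n$ centered at $(\frac1n,0)$, $\mathbb{H}=\bigcup_{n\geq1}C_n$, $b_0=(0,0)$, and $\mathbb{H}^+=\mathbb{H}\cup([-1,0]\times\{0\})$ with basepoint $b_0^+=(-1,0)$. Let $\ell_n$ be the loop based at $b_0$ traversing $C_n$ once counterclockwise and $\iota:[0,1]\to\mathbb{H}^+$, $\iota(t)=(t-1,0)$. Let $\mathcal{C}\subseteq[0,1]$ be the standard middle third Cantor set and write $[0,1]\setminus\mathcal{C}=\bigcup_{n\geq1}\bigcup_{k=1}^{2^{n-1}}I_n^k$, where $I_n^k$ are the components of length $\frac{1}{3^n}$, indexed by $k$ in their natural order. Let $\ell_\tau:[0,1]\to\mathbb{H}$ be the loop with $\ell_\tau(\mathcal{C})=\{b_0\}$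 and equal to $\ell_{2^{n-1}+k-1}$ (linearly reparametrized) on $\overline{I_n^k}$. Put $c_n=[\iota\cdot\ell_n\cdot\iota^{-}]$, $C=\langle c_n\mid n\in\mathbb{N}\rangle\leq\pi_1(\mathbb{H}^+,b_0^+)$, $c_\tau=[\iota\cdot\ell_\tau\cdot\iota^{-}]$. Let $f_{odd},f_{even}:\mathbb{H}\to\mathbb{H}$ be the maps with $f_{odd}\circ\ell_n=\ell_{2n-1}$ and $f_{even}\circ\ell_n=\ell_{2n}$. Put $p_n=[\iota\cdot\ell_{2n-1}\cdot\ell_{2n}^{-}\cdot\iota^{-}]$, $P=\langle p_n\mid n\in\mathbb{N}\rangle\leq\pi_1(\mathbb{H}^+,b_0^+)$, and $p_\tau=[\iota\cdot(f_{odd}\circ\ell_\tau)\cdot(f_{even}\circ\ell_\tau)^{-}\cdot\iota^{-}]$. *)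

theory Defs
  imports "HOL-Analysis.Analysis" "HOL-Algebra.Generated_Groups"
begin

section \<open>Fundamental groups\<close>

definition loops_at :: "'a::topological_space set \<Rightarrow> 'a \<Rightarrow> (real \<Rightarrow> 'a) set" where
  "loops_at X x0 = {p. path p \<and> path_image p \<subseteq> X \<and> pathstart p = x0 \<and> pathfinish p = x0}"

definition path_class :: "'a::topological_space set \<Rightarrow> (real \<Rightarrow> 'a) \<Rightarrow> (real \<Rightarrow> 'a) set" where
  "path_class X p = {q. homotopic_paths X p q}"

definition fundamental_group :: "'a::topological_space set \<Rightarrow> 'a \<Rightarrow> (real \<Rightarrow> 'a) set monoid" where
  "fundamental_group X x0 =
     \<lparr> carrier = path_class X ` loops_at X x0,
       mult = (\<lambda>A B. \<Union>p\<in>A. \<Union>q\<in>B. path_class X (p +++ q)),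
       one = path_class X (\<lambda>_. x0) \<rparr>"

text \<open>The homomorphism induced by a map into \<open>Y\<close>. All the classes in the union coincide,
  see \<open>induced_hom_path_class\<close>.\<close>

definition induced_hom ::
  "'b::topological_space set \<Rightarrow> ('a::topological_space \<Rightarrow> 'b) \<Rightarrow> (real \<Rightarrow> 'a) set \<Rightarrow> (real \<Rightarrow> 'b) set"
  where "induced_hom Y f A = (\<Union>p\<in>A. path_class Y (f \<circ> p))"

definition based_map ::
  "'a::topological_space set \<Rightarrow> 'a \<Rightarrow> 'b::topological_space set \<Rightarrow> 'b \<Rightarrow> ('a \<Rightarrow> 'b) \<Rightarrow> bool"
  where "based_map S s0 X x0 f \<longleftrightarrow> continuous_on S f \<and> f ` S \<subseteq> X \<and> f s0 = x0"

text \<open>\<open>H\<close> is \<open>(T, g)\<close>-closed, for the test space \<open>(S, s0)\<close>. Meant for subgroups \<open>T\<close> and \<open>H\<close> of the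
  respective fundamental groups and for \<open>g\<close> in that of \<open>(S, s0)\<close>.\<close>

definition closed_for ::
  "'a::topological_space set \<Rightarrow> 'a \<Rightarrow> (real \<Rightarrow> 'a) set set \<Rightarrow> (real \<Rightarrow> 'a) set \<Rightarrow>
   'b::topological_space set \<Rightarrow> 'b \<Rightarrow> (real \<Rightarrow> 'b) set set \<Rightarrow> bool"
  where "closed_for S s0 T g X x0 H \<longleftrightarrow>
    (\<forall>f. based_map S s0 X x0 f \<longrightarrow> induced_hom X f ` T \<subseteq> H \<longrightarrow> induced_hom X f g \<in> H)"

lemma path_class_eq_iff:
  assumes "path p" "path_image p \<subseteq> X"
  shows "path_class X p = path_class X q \<longleftrightarrow> homotopic_paths X p q"
proof
  assume "path_class X p = path_class X q"
  then have "homotopic_paths X q p"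
    using assms unfolding path_class_def by (metis homotopic_paths_refl mem_Collect_eq)
  then show "homotopic_paths X p q" by (rule homotopic_paths_sym)
next
  assume "homotopic_paths X p q"
  then show "path_class X p = path_class X q"
    unfolding path_class_def by (blast intro: homotopic_paths_sym homotopic_paths_trans)
qed

lemma mult_path_class:
  assumes "path p" "path_image p \<subseteq> X" "path q" "path_image q \<subseteq> X" "pathfinish p = pathstart q"
  shows "path_class X p \<otimes>\<^bsub>fundamental_group X x0\<^esub> path_class X q = path_class X (p +++ q)"
proof -
  have pq: "path (p +++ q)" "path_image (p +++ q) \<subseteq> X"
    using assms by (auto simp: subset_path_image_join)
  have "path_class X (p' +++ q') = path_class X (p +++ q)"
    if "p' \<in> path_class X p" "q' \<in> path_class X q" for p' q'
  proof -
    have "homotopic_paths X (p +++ q) (p' +++ q')"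
      using that assms(5) by (intro homotopic_paths_join) (auto simp: path_class_def)
    then show ?thesis using path_class_eq_iff[OF pq] by blast
  qed
  moreover have "p \<in> path_class X p" "q \<in> path_class X q"
    using assms by (auto simp: path_class_def)
  ultimately show ?thesis
    unfolding fundamental_group_def monoid.simps by (intro SUP_eq_const) blast+
qed

lemma induced_hom_path_class:
  assumes "path p" "path_image p \<subseteq> S" "continuous_on S f" "f ` S \<subseteq> X"
  shows "induced_hom X f (path_class S p) = path_class X (f \<circ> p)"
proof -
  have fp: "path (f \<circ> p)" "path_image (f \<circ> p) \<subseteq> X"
    using assms by (auto simp: path_image_compose intro: path_continuous_image continuous_on_subset)
  have "path_class X (f \<circ> q) = path_class X (f \<circ> p)" if "q \<in> path_class S p" for q
  proof -
    have "homotopic_paths X (f \<circ> p) (f \<circ> q)"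
      using that assms by (auto simp: path_class_def intro!: homotopic_paths_continuous_image)
    then show ?thesis using path_class_eq_iff[OF fp] by blast
  qed
  moreover have "p \<in> path_class S p"
    using assms by (auto simp: path_class_def)
  ultimately show ?thesis
    unfolding induced_hom_def by (intro SUP_eq_const) blast+
qed

lemma homotopic_paths_const_left:
  fixes p :: "real \<Rightarrow> 'a::topological_space"
  assumes "path p" "path_image p \<subseteq> X" "pathstart p = x0"
  shows "homotopic_paths X ((\<lambda>_. x0) +++ p) p"
proof -
  have "homotopic_paths X p ((\<lambda>_. x0) +++ p)"
  proof (rule homotopic_paths_reparametrize[where f = "\<lambda>t. max 0 (2 * t - 1)"])
    show "continuous_on {0..1} (\<lambda>t::real. max 0 (2 * t - 1))" by (intro continuous_intros)
    show "((\<lambda>_. x0) +++ p) t = p (max 0 (2 * t - 1))" if "t \<in> {0..1}" for t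
    proof (cases "t \<le> 1 / 2")
      case True
      then show ?thesis using assms(3) by (simp add: joinpaths_def pathstart_def max_absorb1)
    qed (simp add: joinpaths_def max_absorb2)
  qed (use assms in auto)
  then show ?thesis by (rule homotopic_paths_sym)
qed

lemma homotopic_paths_inverse_left:
  fixes p :: "real \<Rightarrow> 'a::topological_space"
  assumes p: "path p" "path_image p \<subseteq> X" "pathfinish p = x0"
  shows "homotopic_paths X (reversepath p +++ p) (\<lambda>_. x0)"
proof -
  let ?g = "reversepath (linepath 0 1) +++ linepath 0 (1::real)"
  have g: "homotopic_paths {0..1} ?g (\<lambda>_. 1)"
    using homotopic_paths_linv[of "linepath 0 (1::real)" "{0..1}"]
    by (simp add: linepath_refl closed_segment_eq_real_ivl)
  have "homotopic_paths X (p \<circ> ?g) (p \<circ> (\<lambda>_. 1))"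
    using p by (intro homotopic_paths_continuous_image[OF g])
      (auto simp: path_def path_image_def)
  moreover have "p \<circ> ?g = reversepath p +++ p"
    by (auto simp: joinpaths_def reversepath_def linepath_def fun_eq_iff)
  moreover have "p \<circ> (\<lambda>_::real. 1) = (\<lambda>_. x0)"
    using p by (auto simp: pathfinish_def)
  ultimately show ?thesis by (simp only:)
qed

lemma group_fundamental_group:
  assumes "x0 \<in> X"
  shows "group (fundamental_group X x0)" (is "group ?G")
proof -
  have carrier: "carrier ?G = path_class X ` loops_at X x0"
    by (simp add: fundamental_group_def)
  have one: "\<one>\<^bsub>?G\<^esub> = path_class X (\<lambda>_. x0)"
    by (simp add: fundamental_group_def)
  have c: "(\<lambda>_. x0) \<in> loops_at X x0"
    using assms by (auto simp: loops_at_def path_def path_image_def pathstart_def pathfinish_def)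
  have join: "p +++ q \<in> loops_at X x0" if "p \<in> loops_at X x0" "q \<in> loops_at X x0" for p q
    using that by (auto simp: loops_at_def subset_path_image_join)
  have mult: "path_class X p \<otimes>\<^bsub>?G\<^esub> path_class X q = path_class X (p +++ q)"
    if "p \<in> loops_at X x0" "q \<in> loops_at X x0" for p q
    using that by (intro mult_path_class) (auto simp: loops_at_def)
  have eq: "path_class X p = path_class X q"
    if "p \<in> loops_at X x0" "homotopic_paths X p q" for p q
    using that path_class_eq_iff[of p X q] by (auto simp: loops_at_def)
  show ?thesis
  proof (rule groupI)
    fix x y assume "x \<in> carrier ?G" "y \<in> carrier ?G"
    then show "x \<otimes>\<^bsub>?G\<^esub> y \<in> carrier ?G"
      unfolding carrier using mult join by auto
  next
    show "\<one>\<^bsub>?G\<^esub> \<in> carrier ?G"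
      unfolding carrier one using c by auto
  next
    fix x y z assume "x \<in> carrier ?G" "y \<in> carrier ?G" "z \<in> carrier ?G"
    then obtain p q r where p: "p \<in> loops_at X x0" "x = path_class X p"
      and q: "q \<in> loops_at X x0" "y = path_class X q"
      and r: "r \<in> loops_at X x0" "z = path_class X r"
      unfolding carrier by blast
    have "homotopic_paths X (p +++ (q +++ r)) ((p +++ q) +++ r)"
      using p q r by (intro homotopic_paths_assoc) (auto simp: loops_at_def)
    then have "path_class X (p +++ (q +++ r)) = path_class X ((p +++ q) +++ r)"
      using eq join p q r by blast
    then show "x \<otimes>\<^bsub>?G\<^esub> y \<otimes>\<^bsub>?G\<^esub> z = x \<otimes>\<^bsub>?G\<^esub> (y \<otimes>\<^bsub>?G\<^esub> z)"
      using p q r by (simp add: mult join)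
  next
    fix x assume "x \<in> carrier ?G"
    then obtain p where p: "p \<in> loops_at X x0" "x = path_class X p"
      unfolding carrier by blast
    have "homotopic_paths X ((\<lambda>_. x0) +++ p) p"
      using p by (intro homotopic_paths_const_left) (auto simp: loops_at_def)
    then show "\<one>\<^bsub>?G\<^esub> \<otimes>\<^bsub>?G\<^esub> x = x"
      unfolding one using p c by (simp add: mult eq join)
    have "homotopic_paths X (reversepath p +++ p) (\<lambda>_. x0)"
      using p by (intro homotopic_paths_inverse_left) (auto simp: loops_at_def)
    moreover have r: "reversepath p \<in> loops_at X x0"
      using p by (auto simp: loops_at_def)
    ultimately have "path_class X (reversepath p) \<otimes>\<^bsub>?G\<^esub> x = \<one>\<^bsub>?G\<^esub>"
      unfolding one using p by (simp add: mult eq join)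
    then show "\<exists>y\<in>carrier ?G. y \<otimes>\<^bsub>?G\<^esub> x = \<one>\<^bsub>?G\<^esub>"
      unfolding carrier using r by blast
  qed
qed


section \<open>The Hawaiian earring with a whisker\<close>

definition circle :: "nat \<Rightarrow> (real \<times> real) set" where
  "circle n = sphere (1 / real n, 0) (1 / real n)"

definition hawaiian_earring :: "(real \<times> real) set" where
  "hawaiian_earring = (\<Union>n\<in>{1..}. circle n)"

definition hawaiian_plus :: "(real \<times> real) set" where
  "hawaiian_plus = hawaiian_earring \<union> {-1..0} \<times> {0}"

definition base_plus :: "real \<times> real" where
  "base_plus = (-1, 0)"

definition ell :: "nat \<Rightarrow> real \<Rightarrow> real \<times> real" where
  "ell n t = (1 / real n + cos (pi + 2 * pi * t) / real n, sin (pi + 2 * pi * t) / real n)"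

definition whisker :: "real \<Rightarrow> real \<times> real" where
  "whisker t = (t - 1, 0)"

definition whisker_class :: "(real \<Rightarrow> real \<times> real) \<Rightarrow> (real \<Rightarrow> real \<times> real) set" where
  "whisker_class p = path_class hawaiian_plus (whisker +++ p +++ reversepath whisker)"

text \<open>The self-map \<open>h\<close> of the earring with \<open>h \<circ> ell n = ell (\<sigma> n)\<close> on \<open>[0,1]\<close> for all \<open>n \<ge> 1\<close>
  (see \<open>circle_map_ell\<close>); this determines it, as the loops \<open>ell n\<close> cover the earring.\<close>

definition circle_map :: "(nat \<Rightarrow> nat) \<Rightarrow> real \<times> real \<Rightarrow> real \<times> real" where
  "circle_map \<sigma> z = (THE w. \<exists>n\<ge>1. \<exists>t\<in>{0..1}. z = ell n t \<and> w = ell (\<sigma> n) t)"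

definition f_odd :: "real \<times> real \<Rightarrow> real \<times> real" where
  "f_odd = circle_map (\<lambda>n. 2 * n - 1)"

definition f_even :: "real \<times> real \<Rightarrow> real \<times> real" where
  "f_even = circle_map (\<lambda>n. 2 * n)"

lemma circle_map_ell:
  assumes "n \<ge> 1" "t \<in> {0..1}"
  shows "circle_map \<sigma> (ell n t) = ell (\<sigma> n) t"
  unfolding circle_map_def
proof (rule the_equality)
  show "\<exists>m\<ge>1. \<exists>s\<in>{0..1}. ell n t = ell m s \<and> ell (\<sigma> n) t = ell (\<sigma> m) s"
    using assms by blast
next
  fix w assume "\<exists>m\<ge>1. \<exists>s\<in>{0..1}. ell n t = ell m s \<and> w = ell (\<sigma> m) s"
  then obtain m s where m: "m \<ge> 1" and eq: "ell n t = ell m s" and w: "w = ell (\<sigma> m) s"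
    by blast
  define a where "a = 1 - cos (2 * pi * t)"
  define b where "b = 1 - cos (2 * pi * s)"
  define u where "u = - sin (2 * pi * t)"
  define v where "v = - sin (2 * pi * s)"
  have ell: "ell k t = (a / real k, u / real k)" "ell k s = (b / real k, v / real k)" for k
    by (simp_all add: ell_def a_def b_def u_def v_def cos_add sin_add diff_divide_distrib)
  have sq: "a\<^sup>2 + u\<^sup>2 = 2 * a" "b\<^sup>2 + v\<^sup>2 = 2 * b"
    using sin_cos_squared_add[of "2 * pi * t"] sin_cos_squared_add[of "2 * pi * s"]
    by (simp_all add: a_def b_def u_def v_def power2_eq_square algebra_simps)
  have e: "a * m = b * n" "u * m = v * n"
    using eq m assms by (auto simp: ell field_simps)
  have "(a\<^sup>2 + u\<^sup>2) * m\<^sup>2 = (b\<^sup>2 + v\<^sup>2) * n\<^sup>2"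
    using e by (simp add: distrib_right flip: power_mult_distrib)
  then have "a * m * m = b * n * n"
    unfolding sq by (simp add: power2_eq_square)
  then have "b * n * (real m - real n) = 0"
    using e by (simp add: algebra_simps)
  then consider "b = 0" | "m = n" using assms by auto
  then have "a = b \<and> u = v \<and> (m = n \<or> a = 0 \<and> u = 0)"
  proof cases
    case 1
    then have "a = 0" using e m by auto
    then show ?thesis using 1 sq by simp
  next
    case 2
    then show ?thesis using e m by simp
  qed
  then show "w = ell (\<sigma> n) t"
    unfolding w ell by auto
qed


section \<open>The Cantor set and the loop running over its gaps\<close>

primrec cantor_stage :: "nat \<Rightarrow> real set" where
  "cantor_stage 0 = {0..1}"
| "cantor_stage (Suc n) =
     (\<lambda>x. x / 3) ` cantor_stage n \<union> (\<lambda>x. x / 3 + 2 / 3) ` cantor_stage n"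

definition cantor_set :: "real set" where
  "cantor_set = (\<Inter>n. cantor_stage n)"

text \<open>For \<open>n \<ge> 1\<close>; there are \<open>2 ^ (n - 1)\<close> gaps of length \<open>1 / 3 ^ n\<close>.\<close>

definition gaps :: "nat \<Rightarrow> real set set" where
  "gaps n = {I \<in> components ({0..1} - cantor_set). measure lborel I = 1 / 3 ^ n}"

text \<open>The \<open>k\<close>-th such gap from the left, where \<open>1 \<le> k \<le> 2 ^ (n - 1)\<close>.\<close>

definition gap :: "nat \<Rightarrow> nat \<Rightarrow> real set" where
  "gap n k = (THE I. I \<in> gaps n \<and> card {J \<in> gaps n. Inf J \<le> Inf I} = k)"

definition ell_tau :: "real \<Rightarrow> real \<times> real" where
  "ell_tau t =
    (if t \<in> {0..1} - cantor_set
     then THE w. \<exists>n\<ge>1. \<exists>k\<in>{1..2 ^ (n - 1)}. t \<in> gap n k \<and>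
            w = ell (2 ^ (n - 1) + k - 1) ((t - Inf (gap n k)) / (Sup (gap n k) - Inf (gap n k)))
     else (0, 0))"


section \<open>The test subgroups and elements\<close>

definition pi1_plus :: "(real \<Rightarrow> real \<times> real) set monoid" where
  "pi1_plus = fundamental_group hawaiian_plus base_plus"

definition C_subgroup :: "(real \<Rightarrow> real \<times> real) set set" where
  "C_subgroup = generate pi1_plus {whisker_class (ell n) | n. n \<ge> 1}"

definition c_tau :: "(real \<Rightarrow> real \<times> real) set" where
  "c_tau = whisker_class ell_tau"

definition P_subgroup :: "(real \<Rightarrow> real \<times> real) set set" where
  "P_subgroup =
     generate pi1_plus {whisker_class (ell (2 * n - 1) +++ reversepath (ell (2 * n))) | n. n \<ge> 1}"

definition p_tau :: "(real \<Rightarrow> real \<times> real) set" where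
  "p_tau = whisker_class ((f_odd \<circ> ell_tau) +++ reversepath (f_even \<circ> ell_tau))"

end

theory Submission
  imports Defs
begin

text \<open>
  There is a based self-map \<open>h\<close> of the whiskered earring (\<open>odd_collapse\<close> below) that fixes the
  whisker, winds the circle number \<open>2n - 1\<close> once around the circle number \<open>n\<close>, and crushes every
  circle of even index to the point where the earring meets the whisker. Then \<open>h \<circ> f_odd\<close> is the
  identity and \<open>h \<circ> f_even\<close> is constant on the earring. So the second factor of a product
  \<open>(f_odd \<circ> p) \<cdot> (f_even \<circ> p)\<^sup>-\<close> disappears under \<open>h\<close>, and the first factor becomes \<open>p\<close>. With
  \<open>p = ell n\<close> this says that \<open>h\<close> sends the generators of \<open>P\<close> to those of \<open>C\<close>, and with
  \<open>p = ell_tau\<close> that it sends \<open>p_tau\<close> to \<open>c_tau\<close>. If \<open>f\<close> is a map that carries \<open>C\<close> into \<open>H\<close>,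
  then \<open>f \<circ> h\<close> carries \<open>P\<close> into \<open>H\<close>; the closure hypothesis puts the image of \<open>p_tau\<close> under
  \<open>f \<circ> h\<close>, which is the image of \<open>c_tau\<close> under \<open>f\<close>, into \<open>H\<close>.

  Two analytic facts carry this argument. Maps of the earring that carry each circle to a
  circle or crush it are continuous as long as they stretch all circles by a bounded factor (\<open>continuous_on_circle_map\<close>);
  this covers \<open>f_odd\<close>, \<open>f_even\<close> and \<open>h\<close>. And \<open>ell_tau\<close> is a loop in the earring
  (\<open>ell_tau_loop\<close>). For the latter the gaps of the Cantor set are enumerated explicitly, because
  \<open>gap n k\<close> selects a gap by its rank from the left and picks a gap for every positive \<open>k \<le> 2 ^ (n - 1)\<close>
  only because there are exactly \<open>2 ^ (n - 1)\<close> gaps of length \<open>1 / 3 ^ n\<close>. Continuity then follows by uniform approximation: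
  the loops over the gaps of level \<open>n\<close> have diameter of order \<open>2 ^ - n\<close>, and there are finitely
  many of them for each \<open>n\<close>.
\<close>

section \<open>Induced homomorphisms\<close>

lemma induced_hom_is_hom:
  assumes "based_map S s0 X x0 f"
  shows "induced_hom X f \<in> hom (fundamental_group S s0) (fundamental_group X x0)"
proof (rule homI)
  have f: "continuous_on S f" "f ` S \<subseteq> X" "f s0 = x0"
    using assms by (auto simp: based_map_def)
  have carrier: "carrier (fundamental_group S s0) = path_class S ` loops_at S s0"
    "carrier (fundamental_group X x0) = path_class X ` loops_at X x0"
    by (simp_all add: fundamental_group_def)
  have loop: "f \<circ> p \<in> loops_at X x0" if "p \<in> loops_at S s0" for p
    using that f
    by (auto simp: loops_at_def path_image_compose pathstart_compose pathfinish_compose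
        intro: path_continuous_image continuous_on_subset)
  have hom: "induced_hom X f (path_class S p) = path_class X (f \<circ> p)" if "p \<in> loops_at S s0" for p
    using that f by (intro induced_hom_path_class) (auto simp: loops_at_def)
  show "induced_hom X f A \<in> carrier (fundamental_group X x0)"
    if "A \<in> carrier (fundamental_group S s0)" for A
    using that loop hom unfolding carrier by auto
  fix A B assume "A \<in> carrier (fundamental_group S s0)" "B \<in> carrier (fundamental_group S s0)"
  then obtain p q where p: "p \<in> loops_at S s0" "A = path_class S p"
    and q: "q \<in> loops_at S s0" "B = path_class S q"
    unfolding carrier by blast
  have "p +++ q \<in> loops_at S s0"
    using p q by (auto simp: loops_at_def subset_path_image_join)
  moreover have "path_class S p \<otimes>\<^bsub>fundamental_group S s0\<^esub> path_class S q = path_class S (p +++ q)"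
    using p q by (intro mult_path_class) (auto simp: loops_at_def)
  moreover have "path_class X (f \<circ> p) \<otimes>\<^bsub>fundamental_group X x0\<^esub> path_class X (f \<circ> q)
      = path_class X ((f \<circ> p) +++ (f \<circ> q))"
    using loop[OF p(1)] loop[OF q(1)] by (intro mult_path_class) (auto simp: loops_at_def)
  ultimately show "induced_hom X f (A \<otimes>\<^bsub>fundamental_group S s0\<^esub> B) =
      induced_hom X f A \<otimes>\<^bsub>fundamental_group X x0\<^esub> induced_hom X f B"
    using p q by (simp add: hom path_compose_join)
qed

lemma based_map_compose:
  assumes "based_map R r0 S s0 g" "based_map S s0 X x0 f"
  shows "based_map R r0 X x0 (f \<circ> g)"
  using assms continuous_on_compose[of R g f] continuous_on_subset[of S f "g ` R"]
  unfolding based_map_def by auto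

lemma induced_hom_compose:
  assumes "based_map R r0 S s0 g" "based_map S s0 X x0 f" "A \<in> carrier (fundamental_group R r0)"
  shows "induced_hom X (f \<circ> g) A = induced_hom X f (induced_hom S g A)"
proof -
  have g: "continuous_on R g" "g ` R \<subseteq> S" and f: "continuous_on S f" "f ` S \<subseteq> X"
    using assms by (auto simp: based_map_def)
  obtain p where p: "path p" "path_image p \<subseteq> R" "A = path_class R p"
    using assms(3) by (auto simp: fundamental_group_def loops_at_def)
  have gp: "path (g \<circ> p)" "path_image (g \<circ> p) \<subseteq> S"
    using p g by (auto simp: path_image_compose intro: path_continuous_image continuous_on_subset)
  have fg: "continuous_on R (f \<circ> g)" "(f \<circ> g) ` R \<subseteq> X"
    using based_map_compose[OF assms(1,2)] by (auto simp: based_map_def)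
  show ?thesis
    unfolding p(3) induced_hom_path_class[OF p(1,2) g] induced_hom_path_class[OF p(1,2) fg]
      induced_hom_path_class[OF gp f] by (simp add: comp_assoc)
qed

section \<open>Circle maps of the earring\<close>

lemma circle_iff:
  assumes "n \<ge> 1"
  shows "z \<in> circle n \<longleftrightarrow> real n * ((fst z)\<^sup>2 + (snd z)\<^sup>2) = 2 * fst z"
proof -
  have "z \<in> circle n \<longleftrightarrow> (1 / n - fst z)\<^sup>2 + (snd z)\<^sup>2 = (1 / n)\<^sup>2"
    by (cases z) (auto simp: circle_def dist_Pair_Pair dist_real_def real_sqrt_eq_iff
        real_sqrt_unique dest: arg_cong[where f = "\<lambda>x. x\<^sup>2"])
  also have "(1 / n - fst z)\<^sup>2 + (snd z)\<^sup>2 =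
      (1 / n)\<^sup>2 + (real n * ((fst z)\<^sup>2 + (snd z)\<^sup>2) - 2 * fst z) / n"
    using assms by (simp add: field_simps power2_eq_square)
  also have "\<dots> = (1 / n)\<^sup>2 \<longleftrightarrow> real n * ((fst z)\<^sup>2 + (snd z)\<^sup>2) = 2 * fst z"
    using assms by simp
  finally show ?thesis .
qed

lemma ell_in_circle: "n \<ge> 1 \<Longrightarrow> ell n t \<in> circle n"
  using sin_cos_squared_add[of "pi + 2 * pi * t"]
  by (simp add: circle_iff) (simp add: ell_def field_simps power2_eq_square)

lemma circle_in_range_ell:
  assumes "n \<ge> 1" "z \<in> circle n"
  obtains t where "t \<in> {0..1}" "z = ell n t"
proof -
  have "(1 - n * fst z)\<^sup>2 + (- n * snd z)\<^sup>2 = 1 + n * (n * ((fst z)\<^sup>2 + (snd z)\<^sup>2) - 2 * fst z)"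
    by (simp add: power2_eq_square algebra_simps)
  also have "\<dots> = 1"
    using assms by (simp add: circle_iff)
  finally obtain s where s: "0 \<le> s" "s < 2 * pi" "1 - n * fst z = cos s" "- n * snd z = sin s"
    using sincos_total_2pi by metis
  have "z = ell n (s / (2 * pi))"
    using s(3,4) assms(1) by (cases z) (simp add: ell_def cos_add sin_add field_simps)
  then show ?thesis
    using s that[of "s / (2 * pi)"] by (simp add: divide_simps)
qed

lemma ell_index_zero [simp]: "ell 0 t = (0, 0)"
  by (simp add: ell_def)

lemma ell_ends [simp]: "ell n 0 = (0, 0)" "ell n 1 = (0, 0)"
  by (simp_all add: ell_def cos_add sin_add)

lemma zero_in_earring [simp]: "(0, 0) \<in> hawaiian_earring"
  using ell_in_circle[of 1 0] by (auto simp: hawaiian_earring_def)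

lemma ell_in_earring: "ell n t \<in> hawaiian_earring"
proof (cases "n = 0")
  case False
  then show ?thesis
    using ell_in_circle[of n t] by (auto simp: hawaiian_earring_def)
qed simp

lemma earring_cases:
  assumes "z \<in> hawaiian_earring"
  obtains n t where "n \<ge> 1" "t \<in> {0..1}" "z = ell n t"
  using assms circle_in_range_ell unfolding hawaiian_earring_def by blast

lemma earring_nonneg: "z \<in> hawaiian_earring \<Longrightarrow> 0 \<le> fst z"
proof -
  assume "z \<in> hawaiian_earring"
  then obtain n where "n \<ge> 1" "z \<in> circle n"
    unfolding hawaiian_earring_def by blast
  then have "2 * fst z = real n * ((fst z)\<^sup>2 + (snd z)\<^sup>2)"
    by (simp add: circle_iff)
  also have "\<dots> \<ge> 0" by simp
  finally show "0 \<le> fst z" by simp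
qed

lemma earring_fst_zero: "z \<in> hawaiian_earring \<Longrightarrow> fst z = 0 \<Longrightarrow> z = (0, 0)"
  by (cases z) (auto simp: hawaiian_earring_def circle_iff)

lemma path_ell: "path (ell n)"
  unfolding path_def ell_def divide_inverse by (intro continuous_intros)

lemma ell_loop: "ell n \<in> loops_at hawaiian_earring (0, 0)"
  using path_ell ell_in_earring by (auto simp: loops_at_def path_image_def pathstart_def pathfinish_def)

text \<open>The circles are homothetic with centre at the origin, so on each circle a circle map is a
  scaling. An index \<open>\<sigma> n = 0\<close> is covered too: \<open>ell 0\<close> is constant since \<open>1 / 0 = 0\<close>, so
  the circle is crushed, and the scaling factor is \<open>0\<close> for the same reason.\<close>

lemma circle_map_scale:
  assumes "n \<ge> 1" "z \<in> circle n"
  shows "circle_map \<sigma> z = (real n / real (\<sigma> n)) *\<^sub>R z"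
proof -
  obtain t where t: "t \<in> {0..1}" "z = ell n t"
    using circle_in_range_ell assms by blast
  show ?thesis
    unfolding t(2) circle_map_ell[OF assms(1) t(1)] using assms(1)
    by (simp add: ell_def distrib_left right_diff_distrib)
qed

lemma circle_map_in_earring:
  assumes "z \<in> hawaiian_earring"
  shows "circle_map \<sigma> z \<in> hawaiian_earring"
  using assms by (rule earring_cases) (simp add: circle_map_ell ell_in_earring)

lemma circle_map_zero [simp]: "circle_map \<sigma> (0, 0) = (0, 0)"
  using circle_map_ell[of 1 0 \<sigma>] by simp

text \<open>Away from the origin the index of the circle through a point is locally constant, so the map is
  locally a fixed scaling. Every neighbourhood of the origin meets all circles, and there it is the
  growth condition that helps: it bounds all scaling factors by \<open>\<bar>K\<bar>\<close>.\<close>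

lemma continuous_on_circle_map:
  fixes K :: real
  assumes growth: "\<And>n. n \<ge> 1 \<Longrightarrow> \<sigma> n = 0 \<or> real n \<le> K * real (\<sigma> n)"
  shows "continuous_on hawaiian_earring (circle_map \<sigma>)"
  unfolding continuous_on_eq_continuous_within
proof
  fix z assume z: "z \<in> hawaiian_earring"
  show "continuous (at z within hawaiian_earring) (circle_map \<sigma>)"
  proof (cases "z = (0, 0)")
    case True
    have bound: "norm (circle_map \<sigma> w) \<le> \<bar>K\<bar> * norm w" if w: "w \<in> hawaiian_earring" for w
    proof -
      obtain n where n: "n \<ge> 1" "w \<in> circle n"
        using w unfolding hawaiian_earring_def by blast
      have "real n / real (\<sigma> n) \<le> \<bar>K\<bar>"
      proof (cases "\<sigma> n = 0")
        case False
        then have "real n \<le> K * real (\<sigma> n)" using growth[OF n(1)] by simp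
        also have "\<dots> \<le> \<bar>K\<bar> * real (\<sigma> n)" by (intro mult_right_mono) auto
        finally show ?thesis using False by (simp add: field_simps)
      qed auto
      then show ?thesis
        unfolding circle_map_scale[OF n] norm_scaleR by (intro mult_right_mono) auto
    qed
    have "((\<lambda>w. \<bar>K\<bar> * norm w) \<longlongrightarrow> \<bar>K\<bar> * norm z) (at z within hawaiian_earring)"
      by (intro tendsto_intros)
    then have "((\<lambda>w. \<bar>K\<bar> * norm w) \<longlongrightarrow> 0) (at z within hawaiian_earring)"
      using True by simp
    then have "(circle_map \<sigma> \<longlongrightarrow> 0) (at z within hawaiian_earring)"
      by (rule Lim_null_comparison[rotated]) (simp add: eventually_at_filter bound)
    then show ?thesis
      using True by (simp add: continuous_within zero_prod_def)
  next
    case False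
    obtain n where n: "n \<ge> 1" "z \<in> circle n"
      using z unfolding hawaiian_earring_def by blast
    \<comment> \<open>At points of the earring other than the origin, \<open>\<phi>\<close> is the index of the circle.\<close>
    define \<phi> where "\<phi> w = 2 * fst w / ((fst w)\<^sup>2 + (snd w)\<^sup>2)" for w :: "real \<times> real"
    have pos: "(fst w)\<^sup>2 + (snd w)\<^sup>2 \<noteq> 0" if "w \<noteq> (0, 0)" for w :: "real \<times> real"
      using that by (cases w) (auto simp: sum_power2_eq_zero_iff)
    have index: "\<phi> w = real m" if "m \<ge> 1" "w \<in> circle m" "w \<noteq> (0, 0)" for w m
      using that pos[of w] by (simp add: circle_iff \<phi>_def divide_eq_eq)
    have "(\<phi> \<longlongrightarrow> \<phi> z) (at z within hawaiian_earring)"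
      unfolding \<phi>_def using pos[OF False] by (intro tendsto_intros)
    then have "eventually (\<lambda>w. dist (\<phi> w) (\<phi> z) < 1) (at z within hawaiian_earring)"
      by (rule tendstoD) simp
    moreover have "eventually (\<lambda>w. w \<noteq> (0, 0)) (at z within hawaiian_earring)"
      using False by (intro tendsto_imp_eventually_ne) auto
    moreover have "eventually (\<lambda>w. w \<in> hawaiian_earring) (at z within hawaiian_earring)"
      by (simp add: eventually_at_filter)
    ultimately have "eventually (\<lambda>w. (real n / real (\<sigma> n)) *\<^sub>R w = circle_map \<sigma> w)
        (at z within hawaiian_earring)"
    proof eventually_elim
      case (elim w)
      obtain m where m: "m \<ge> 1" "w \<in> circle m"
        using elim(3) unfolding hawaiian_earring_def by blast
      have "\<bar>real m - real n\<bar> < 1"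
        using elim(1) index[OF m elim(2)] index[OF n False] by (simp add: dist_real_def)
      then have "m = n" by linarith
      then show ?case using circle_map_scale[OF m] by simp
    qed
    moreover have "((\<lambda>w. (real n / real (\<sigma> n)) *\<^sub>R w) \<longlongrightarrow> (real n / real (\<sigma> n)) *\<^sub>R z)
        (at z within hawaiian_earring)"
      by (intro tendsto_intros)
    ultimately show ?thesis
      unfolding continuous_within circle_map_scale[OF n] by (rule Lim_transform_eventually[rotated])
  qed
qed

section \<open>The gaps of the Cantor set\<close>

text \<open>The left endpoints of the gaps of length \<open>1 / 3 ^ Suc n\<close>. Levels start at \<open>0\<close> here, so that
  level \<open>n\<close> corresponds to \<open>gaps (Suc n)\<close>.\<close>

primrec gap_starts :: "nat \<Rightarrow> real set" where
  "gap_starts 0 = {1 / 3}"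
| "gap_starts (Suc n) = (\<lambda>x. x / 3) ` gap_starts n \<union> (\<lambda>x. x / 3 + 2 / 3) ` gap_starts n"

definition gap_at :: "nat \<Rightarrow> real \<Rightarrow> real set" where
  "gap_at n x = {x <..< x + 1 / 3 ^ Suc n}"

definition gap_rank :: "nat \<Rightarrow> real \<Rightarrow> nat" where
  "gap_rank n x = card {y \<in> gap_starts n. y \<le> x}"

lemma finite_gap_starts [simp]: "finite (gap_starts n)"
  by (induction n) auto

lemma gap_starts_bounds: "x \<in> gap_starts n \<Longrightarrow> 0 \<le> x \<and> x < 1"
  by (induction n arbitrary: x) fastforce+

lemma card_gap_starts: "card (gap_starts n) = 2 ^ n"
proof (induction n)
  case (Suc n)
  have "(\<lambda>x. x / 3) ` gap_starts n \<inter> (\<lambda>x. x / 3 + 2 / 3) ` gap_starts n = {}"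
    by (auto dest!: gap_starts_bounds)
  moreover have "card ((\<lambda>x. x / 3) ` gap_starts n) = 2 ^ n"
    "card ((\<lambda>x. x / 3 + 2 / 3) ` gap_starts n) = 2 ^ n"
    using Suc.IH by (auto simp: card_image inj_on_def)
  ultimately show ?case
    by (simp add: card_Un_disjoint)
qed simp

lemma cantor_stage_subset: "cantor_stage n \<subseteq> {0..1}"
  by (induction n) fastforce+

lemma cantor_set_ends: "0 \<in> cantor_set" "1 \<in> cantor_set"
proof -
  have "0 \<in> cantor_stage n \<and> 1 \<in> cantor_stage n" for n
    by (induction n) (auto simp: image_iff intro: bexI[of _ 0] bexI[of _ 1])
  then show "0 \<in> cantor_set" "1 \<in> cantor_set"
    by (auto simp: cantor_set_def)
qed

lemma cantor_set_third:
  assumes "x \<in> cantor_set"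
  shows "x / 3 \<in> cantor_set" "x / 3 + 2 / 3 \<in> cantor_set"
proof -
  have x: "x \<in> cantor_stage n" for n
    using assms by (auto simp: cantor_set_def)
  have "x / 3 \<in> cantor_stage n \<and> x / 3 + 2 / 3 \<in> cantor_stage n" for n
    using x[of "n - 1"] x[of 0] by (cases n) auto
  then show "x / 3 \<in> cantor_set" "x / 3 + 2 / 3 \<in> cantor_set"
    by (auto simp: cantor_set_def)
qed

lemma gap_ends_in_cantor_set:
  "x \<in> gap_starts n \<Longrightarrow> x \<in> cantor_set \<and> x + 1 / 3 ^ Suc n \<in> cantor_set"
proof (induction n arbitrary: x)
  case 0
  then have "x = 0 / 3 + 1 / 3" "x = 1 / 3" "x + 1 / 3 ^ Suc 0 = 0 / 3 + 2 / 3" by auto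
  then show ?case
    using cantor_set_third(2)[OF cantor_set_ends(1)] cantor_set_third(1)[OF cantor_set_ends(2)] by metis
next
  case (Suc n)
  then obtain y where y: "y \<in> gap_starts n" "x = y / 3 \<or> x = y / 3 + 2 / 3"
    by auto
  have "x + 1 / 3 ^ Suc (Suc n) = (y + 1 / 3 ^ Suc n) / 3 \<or>
      x + 1 / 3 ^ Suc (Suc n) = (y + 1 / 3 ^ Suc n) / 3 + 2 / 3"
    using y(2) by (auto simp: add_divide_distrib)
  then show ?case
    using y Suc.IH[OF y(1)] cantor_set_third by metis
qed

lemma gap_at_third:
  "y \<in> gap_at (Suc n) (x / 3) \<longleftrightarrow> 3 * y \<in> gap_at n x"
  "y \<in> gap_at (Suc n) (x / 3 + 2 / 3) \<longleftrightarrow> 3 * y - 2 \<in> gap_at n x"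
proof -
  have "1 / 3 ^ Suc (Suc n) = (1 / 3 ^ Suc n :: real) / 3"
    by simp
  then show "y \<in> gap_at (Suc n) (x / 3) \<longleftrightarrow> 3 * y \<in> gap_at n x"
    "y \<in> gap_at (Suc n) (x / 3 + 2 / 3) \<longleftrightarrow> 3 * y - 2 \<in> gap_at n x"
    unfolding gap_at_def by (auto simp del: power_Suc)
qed

text \<open>The complement of a stage satisfies the same recursion as the gaps do: the middle third, together
  with the two scaled copies of the previous complement.\<close>

lemma cantor_stage_complement:
  "{0..1} - cantor_stage n = (\<Union>m<n. \<Union>x\<in>gap_starts m. gap_at m x)"
proof (induction n)
  case (Suc n)
  have third: "y \<in> cantor_stage (Suc n) \<longleftrightarrow> 3 * y \<in> cantor_stage n \<or> 3 * y - 2 \<in> cantor_stage n"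
    for y
  proof -
    have "y \<in> (\<lambda>x. x / 3) ` cantor_stage n \<longleftrightarrow> 3 * y \<in> cantor_stage n"
      by (auto simp: image_iff mult.commute)
    moreover have "y \<in> (\<lambda>x. x / 3 + 2 / 3) ` cantor_stage n \<longleftrightarrow> 3 * y - 2 \<in> cantor_stage n"
    proof -
      have "y = x / 3 + 2 / 3 \<longleftrightarrow> x = 3 * y - 2" for x
        by linarith
      then show ?thesis by (simp add: image_iff)
    qed
    ultimately show ?thesis by simp
  qed
  let ?U = "\<lambda>n. \<Union>m<n. \<Union>x\<in>gap_starts m. gap_at m x"
  have U: "y \<in> ?U (Suc n) \<longleftrightarrow> y \<in> {1/3<..<2/3} \<or> 3 * y \<in> ?U n \<or> 3 * y - 2 \<in> ?U n" for y
    unfolding lessThan_Suc_eq_insert_0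
    by (auto simp: gap_at_third gap_at_def[of 0])
  have IH: "z \<in> ?U n \<longleftrightarrow> z \<in> {0..1} \<and> z \<notin> cantor_stage n" for z
    using Suc.IH by blast
  show ?case
  proof (rule Set.set_eqI)
    fix y
    have "0 \<le> y \<and> y \<le> 1 / 3" if "3 * y \<in> cantor_stage n"
      using subsetD[OF cantor_stage_subset that] by simp
    moreover have "2 / 3 \<le> y \<and> y \<le> 1" if "3 * y - 2 \<in> cantor_stage n"
      using subsetD[OF cantor_stage_subset that] by simp
    ultimately show "y \<in> {0..1} - cantor_stage (Suc n) \<longleftrightarrow> y \<in> ?U (Suc n)"
      unfolding U IH Diff_iff third atLeastAtMost_iff greaterThanLessThan_iff by auto
  qed
qed simp

lemma cantor_set_complement:
  "{0..1} - cantor_set = (\<Union>n. \<Union>x\<in>gap_starts n. gap_at n x)"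
proof -
  have "{0..1} - cantor_set = (\<Union>n. {0..1} - cantor_stage n)"
    by (auto simp: cantor_set_def)
  also have "\<dots> = (\<Union>n. \<Union>x\<in>gap_starts n. gap_at n x)"
    unfolding cantor_stage_complement by blast
  finally show ?thesis .
qed

lemma gap_at_inject:
  assumes "gap_at n x = gap_at m y"
  shows "n = m \<and> x = y"
proof -
  have *: "Inf (gap_at k z) = z" "Sup (gap_at k z) = z + 1 / 3 ^ Suc k" for k z
    by (auto simp: gap_at_def)
  have "x = y" "x + 1 / 3 ^ Suc n = y + 1 / 3 ^ Suc m"
    using assms * by metis+
  then show ?thesis by simp
qed

text \<open>If two distinct open intervals overlap, one of them contains an endpoint of the other. Endpoints
  of gaps belong to the Cantor set, which the gaps avoid.\<close>

lemma gap_at_disjoint: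
  assumes "x \<in> gap_starts n" "y \<in> gap_starts m" "t \<in> gap_at n x" "t \<in> gap_at m y"
  shows "n = m \<and> x = y"
proof -
  have "z \<notin> cantor_set" if "z \<in> gap_at k w" "w \<in> gap_starts k" for z w k
    using that cantor_set_complement by blast
  then have "x \<notin> gap_at m y" "x + 1 / 3 ^ Suc n \<notin> gap_at m y"
    "y \<notin> gap_at n x" "y + 1 / 3 ^ Suc m \<notin> gap_at n x"
    using assms gap_ends_in_cantor_set by blast+
  then have "gap_at n x = gap_at m y"
    using assms(3,4) unfolding gap_at_def by auto
  then show ?thesis by (rule gap_at_inject)
qed

lemma components_cantor_complement:
  "components ({0..1} - cantor_set) = (\<Union>n. gap_at n ` gap_starts n)"
proof (rule components_open_unique)
  show "pairwise disjnt (\<Union>n. gap_at n ` gap_starts n)"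
    by (auto simp: pairwise_def disjnt_def dest: gap_at_disjoint)
  show "\<Union> (\<Union>n. gap_at n ` gap_starts n) = {0..1} - cantor_set"
    by (auto simp: cantor_set_complement)
  show "open I \<and> connected I \<and> I \<noteq> {}" if "I \<in> (\<Union>n. gap_at n ` gap_starts n)" for I
    using that by (auto simp: gap_at_def power_le_zero_eq)
qed

lemma gaps_eq: "gaps (Suc n) = gap_at n ` gap_starts n"
proof -
  have "measure lborel (gap_at m x) = 1 / 3 ^ Suc m" for m x
    by (simp add: gap_at_def)
  moreover have "1 / 3 ^ Suc m = (1 / 3 ^ Suc n :: real) \<longleftrightarrow> m = n" for m
    by simp
  ultimately show ?thesis
    unfolding gaps_def components_cantor_complement by auto
qed

text \<open>The rank is strictly increasing, hence injective, and there are as many gaps as possible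
  ranks.\<close>

lemma gap_rank_bij: "bij_betw (gap_rank n) (gap_starts n) {1..2 ^ n}"
proof -
  have less: "gap_rank n x < gap_rank n y" if "y \<in> gap_starts n" "x < y" for x y
    unfolding gap_rank_def using that by (intro psubset_card_mono) force+
  have inj: "inj_on (gap_rank n) (gap_starts n)"
    by (rule inj_onI) (metis less linorder_neqE less_irrefl)
  have "gap_rank n x \<in> {1..2 ^ n}" if "x \<in> gap_starts n" for x
    using that card_mono[of "gap_starts n" "{y \<in> gap_starts n. y \<le> x}"]
    by (auto simp: gap_rank_def card_gap_starts Suc_le_eq card_gt_0_iff)
  then have "gap_rank n ` gap_starts n = {1..2 ^ n}"
    by (intro card_subset_eq) (auto simp: card_image[OF inj] card_gap_starts)
  with inj show ?thesis by (simp add: bij_betw_def)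
qed

lemma gap_eq:
  assumes "x \<in> gap_starts n"
  shows "gap (Suc n) (gap_rank n x) = gap_at n x"
proof -
  have Inf: "Inf (gap_at n y) = y" for y
    by (simp add: gap_at_def)
  have rank: "card {J \<in> gaps (Suc n). Inf J \<le> Inf (gap_at n y)} = gap_rank n y" for y
  proof -
    have "{J \<in> gaps (Suc n). Inf J \<le> Inf (gap_at n y)} = gap_at n ` {z \<in> gap_starts n. z \<le> y}"
      unfolding gaps_eq Inf by (auto simp: Inf)
    moreover have "inj_on (gap_at n) A" for A
      by (rule inj_onI) (auto dest: gap_at_inject)
    ultimately show ?thesis
      by (simp add: card_image gap_rank_def)
  qed
  show ?thesis
    unfolding gap_def
  proof (rule the_equality)
    show "gap_at n x \<in> gaps (Suc n) \<and>
        card {J \<in> gaps (Suc n). Inf J \<le> Inf (gap_at n x)} = gap_rank n x"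
      using assms rank gaps_eq by blast
  next
    fix I assume I: "I \<in> gaps (Suc n) \<and> card {J \<in> gaps (Suc n). Inf J \<le> Inf I} = gap_rank n x"
    then obtain y where y: "y \<in> gap_starts n" "I = gap_at n y"
      by (auto simp: gaps_eq)
    then have "gap_rank n y = gap_rank n x"
      using I rank by simp
    then show "I = gap_at n x"
      using y assms gap_rank_bij[of n] by (auto simp: bij_betw_def dest: inj_onD)
  qed
qed

section \<open>The loop running over the gaps\<close>

text \<open>The part of \<open>ell_tau\<close> that runs over one gap, continued by the origin to a function that is
  continuous on the whole line: the clamped parameter is \<open>0\<close> or \<open>1\<close> outside the gap.\<close>

definition gap_loop :: "nat \<Rightarrow> real \<Rightarrow> real \<Rightarrow> real \<times> real" where
  "gap_loop n x t = ell (2 ^ n + gap_rank n x - 1) (max 0 (min 1 ((t - x) * 3 ^ Suc n)))"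

lemma gap_loop_outside:
  assumes "t \<notin> gap_at n x"
  shows "gap_loop n x t = (0, 0)"
proof -
  have "(t - x) * 3 ^ Suc n \<le> 0 \<or> 1 \<le> (t - x) * 3 ^ Suc n"
    using assms by (auto simp: gap_at_def mult_le_0_iff field_simps)
  then show ?thesis
    by (auto simp: gap_loop_def max_def min_def)
qed

lemma ell_tau_cantor: "t \<in> cantor_set \<Longrightarrow> ell_tau t = (0, 0)"
  by (simp add: ell_tau_def)

lemma ell_tau_gap:
  assumes x: "x \<in> gap_starts n" and t: "t \<in> gap_at n x"
  shows "ell_tau t = gap_loop n x t"
proof -
  define w where "w n k = ell (2 ^ (n - 1) + k - 1)
    ((t - Inf (gap n k)) / (Sup (gap n k) - Inf (gap n k)))" for n k
  have w: "w (Suc n) (gap_rank n x) = gap_loop n x t"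
  proof -
    have "Inf (gap_at n x) = x" "Sup (gap_at n x) = x + 1 / 3 ^ Suc n"
      by (simp_all add: gap_at_def)
    moreover have "0 \<le> (t - x) * 3 ^ Suc n" "(t - x) * 3 ^ Suc n \<le> 1"
      using t by (auto simp: gap_at_def field_simps)
    ultimately show ?thesis
      by (simp add: w_def gap_eq[OF x] gap_loop_def max_absorb2 min_absorb2)
  qed
  have "(THE v. \<exists>m\<ge>1. \<exists>k\<in>{1..2 ^ (m - 1)}. t \<in> gap m k \<and> v = w m k) = gap_loop n x t"
  proof (rule the_equality)
    have "gap_rank n x \<in> {1..2 ^ n}"
      using gap_rank_bij[of n] x by (auto simp: bij_betw_def)
    then show "\<exists>m\<ge>1. \<exists>k\<in>{1..2 ^ (m - 1)}. t \<in> gap m k \<and> gap_loop n x t = w m k"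
      using t w by (intro exI[of _ "Suc n"] conjI bexI[of _ "gap_rank n x"]) (auto simp: gap_eq[OF x])
  next
    fix v assume "\<exists>m\<ge>1. \<exists>k\<in>{1..2 ^ (m - 1)}. t \<in> gap m k \<and> v = w m k"
    then obtain m k where mk: "m \<ge> 1" "k \<in> {1..2 ^ (m - 1)}" "t \<in> gap m k" "v = w m k"
      by blast
    obtain l where l: "m = Suc l" using mk(1) by (cases m) auto
    have "k \<in> gap_rank l ` gap_starts l"
      using mk(2) bij_betw_imp_surj_on[OF gap_rank_bij[of l]] l by simp
    then obtain y where y: "y \<in> gap_starts l" "k = gap_rank l y"
      by blast
    have "n = l \<and> x = y"
      using gap_at_disjoint[OF x y(1) t] mk(3) unfolding l y(2) gap_eq[OF y(1)] by blast
    then show "v = gap_loop n x t"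
      using mk(4) w l y by simp
  qed
  moreover have "t \<in> {0..1} - cantor_set"
    using x t cantor_set_complement by blast
  ultimately show ?thesis
    by (simp add: ell_tau_def w_def)
qed

lemma norm_ell_le: "norm (ell m s) \<le> 3 / real m"
proof -
  have "norm (ell m s) \<le> \<bar>fst (ell m s)\<bar> + \<bar>snd (ell m s)\<bar>"
    using sqrt_sum_squares_le_sum_abs by (simp add: norm_prod_def)
  also have "\<dots> = \<bar>1 + cos (pi + 2 * pi * s)\<bar> / m + \<bar>sin (pi + 2 * pi * s)\<bar> / m"
    by (simp only: ell_def fst_conv snd_conv abs_divide abs_of_nat flip: add_divide_distrib)
  also have "\<dots> \<le> 2 / m + 1 / m"
    using cos_le_one[of "pi + 2 * pi * s"] cos_ge_minus_one[of "pi + 2 * pi * s"]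
    by (intro add_mono divide_right_mono) (auto simp: abs_le_iff)
  finally show ?thesis by (simp add: add_divide_distrib[symmetric])
qed

lemma norm_gap_loop_le:
  assumes "x \<in> gap_starts n"
  shows "norm (gap_loop n x t) \<le> 3 / 2 ^ n"
proof -
  have "gap_rank n x \<ge> 1"
    using gap_rank_bij[of n] assms by (auto simp: bij_betw_def)
  then have "real (2 ^ n) \<le> real (2 ^ n + gap_rank n x - 1)"
    unfolding of_nat_le_iff by linarith
  then have "3 / real (2 ^ n + gap_rank n x - 1) \<le> 3 / real (2 ^ n)"
    by (intro frac_le) auto
  then have "3 / real (2 ^ n + gap_rank n x - 1) \<le> 3 / 2 ^ n"
    by simp
  then show ?thesis
    unfolding gap_loop_def using norm_ell_le order_trans by blast
qed

text \<open>At most one summand is not zero at a given point, so the partial sum agrees with \<open>ell_tau\<close>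
  except on the gaps of level \<open>N\<close> and above, where it vanishes and \<open>ell_tau\<close> runs on small
  circles.\<close>

lemma ell_tau_partial_sum:
  assumes "t \<in> {0..1}"
  shows "norm ((\<Sum>n<N. \<Sum>x\<in>gap_starts n. gap_loop n x t) - ell_tau t) \<le> 3 / 2 ^ N"
proof (cases "t \<in> cantor_set")
  case True
  then have "t \<notin> gap_at n x" if "x \<in> gap_starts n" for n x
    using that cantor_set_complement by blast
  then have "(\<Sum>n<N. \<Sum>x\<in>gap_starts n. gap_loop n x t) = 0"
    by (simp add: gap_loop_outside sum.neutral flip: zero_prod_def)
  then show ?thesis
    by (simp add: ell_tau_cantor[OF True] flip: zero_prod_def)
next
  case False
  then obtain m y where y: "y \<in> gap_starts m" "t \<in> gap_at m y"
    using assms cantor_set_complement by blast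
  have "(\<Sum>x\<in>gap_starts n. gap_loop n x t) = (if n = m then ell_tau t else 0)" for n
  proof -
    have "gap_loop n x t = 0" if "x \<in> gap_starts n" "\<not> (n = m \<and> x = y)" for x
      using that y gap_at_disjoint[of x n y m t] gap_loop_outside[of t n x]
      by (auto simp: zero_prod_def)
    then have "(\<Sum>x\<in>gap_starts n. gap_loop n x t)
        = (\<Sum>x\<in>gap_starts n. if x = y \<and> n = m then ell_tau t else 0)"
      using ell_tau_gap[OF y] by (intro sum.cong) auto
    then show ?thesis using y by (cases "n = m") auto
  qed
  then have sum: "(\<Sum>n<N. \<Sum>x\<in>gap_starts n. gap_loop n x t) = (if m < N then ell_tau t else 0)"
    by simp
  have "norm (ell_tau t) \<le> 3 / 2 ^ N" if "N \<le> m"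
  proof -
    have "norm (ell_tau t) \<le> 3 / 2 ^ m"
      unfolding ell_tau_gap[OF y] by (rule norm_gap_loop_le[OF y(1)])
    also have "\<dots> \<le> 3 / 2 ^ N"
      using that by (intro divide_left_mono power_increasing) auto
    finally show ?thesis .
  qed
  then show ?thesis unfolding sum by auto
qed

lemma continuous_on_ell_tau: "continuous_on {0..1} ell_tau"
proof (rule uniform_limit_theorem)
  have "continuous_on {0..1} (gap_loop n x)" for n x
    unfolding gap_loop_def[abs_def] ell_def divide_inverse by (intro continuous_intros)
  then show "\<forall>\<^sub>F N in sequentially.
      continuous_on {0..1} (\<lambda>t. \<Sum>n<N. \<Sum>x\<in>gap_starts n. gap_loop n x t)"
    by (intro always_eventually allI continuous_on_sum)
  show "uniform_limit {0..1} (\<lambda>N t. \<Sum>n<N. \<Sum>x\<in>gap_starts n. gap_loop n x t) ell_tau sequentially"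
  proof (rule uniform_limitI)
    fix e :: real assume "e > 0"
    have "(\<lambda>N. 3 / 2 ^ N :: real) \<longlonglongrightarrow> 0"
      using tendsto_mult_left[OF LIMSEQ_power_zero[of "1 / 2 :: real"], of 3]
      by (simp add: power_one_over)
    then have "\<forall>\<^sub>F N in sequentially. 3 / 2 ^ N < e"
      using \<open>e > 0\<close> by (rule order_tendstoD)
    then show "\<forall>\<^sub>F N in sequentially. \<forall>t\<in>{0..1}.
        dist (\<Sum>n<N. \<Sum>x\<in>gap_starts n. gap_loop n x t) (ell_tau t) < e"
    proof eventually_elim
      case (elim N)
      then show ?case
        using order.strict_trans1[OF ell_tau_partial_sum elim] by (simp add: dist_norm)
    qed
  qed
qed simp

lemma ell_tau_loop: "ell_tau \<in> loops_at hawaiian_earring (0, 0)"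
proof -
  have "ell_tau t \<in> hawaiian_earring" if t: "t \<in> {0..1}" for t
  proof (cases "t \<in> cantor_set")
    case False
    then obtain n x where x: "x \<in> gap_starts n" "t \<in> gap_at n x"
      using t cantor_set_complement by blast
    show ?thesis
      unfolding ell_tau_gap[OF x] gap_loop_def by (rule ell_in_earring)
  qed (simp add: ell_tau_cantor)
  then show ?thesis
    using continuous_on_ell_tau
    by (auto simp: loops_at_def path_def path_image_def pathstart_def pathfinish_def
        ell_tau_cantor cantor_set_ends)
qed

section \<open>Collapsing the even circles\<close>

text \<open>The inverse of \<open>n \<mapsto> 2n - 1\<close> on odd indices. The value \<open>0\<close> at even indices makes the circle
  map crush the even circles.\<close>

definition odd_index :: "nat \<Rightarrow> nat" where
  "odd_index n = (if odd n then (n + 1) div 2 else 0)"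

definition odd_collapse :: "real \<times> real \<Rightarrow> real \<times> real" where
  "odd_collapse z = (if fst z \<le> 0 then z else circle_map odd_index z)"

lemma odd_collapse_earring:
  assumes "z \<in> hawaiian_earring"
  shows "odd_collapse z = circle_map odd_index z"
  using assms earring_nonneg[of z] earring_fst_zero[of z] by (auto simp: odd_collapse_def)

lemma odd_collapse_ell:
  assumes "n \<ge> 1" "t \<in> {0..1}"
  shows "odd_collapse (ell (2 * n - 1) t) = ell n t" "odd_collapse (ell (2 * n) t) = (0, 0)"
proof -
  have "odd_index (2 * n - 1) = n" "odd_index (2 * n) = 0"
    using assms by (auto simp: odd_index_def)
  then show "odd_collapse (ell (2 * n - 1) t) = ell n t" "odd_collapse (ell (2 * n) t) = (0, 0)"
    using assms by (simp_all add: odd_collapse_earring ell_in_earring circle_map_ell)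
qed

lemma odd_collapse_f_odd:
  assumes "z \<in> hawaiian_earring"
  shows "odd_collapse (f_odd z) = z"
  using assms by (rule earring_cases) (simp add: f_odd_def circle_map_ell odd_collapse_ell del: One_nat_def)

lemma odd_collapse_f_even:
  assumes "z \<in> hawaiian_earring"
  shows "odd_collapse (f_even z) = (0, 0)"
  using assms by (rule earring_cases) (simp add: f_even_def circle_map_ell odd_collapse_ell)

text \<open>The two branches are continuous on the whisker and on the earring, which are cut out by the
  sign of the first coordinate and meet only in the origin, a fixed point of both.\<close>

lemma based_map_odd_collapse:
  "based_map hawaiian_plus base_plus hawaiian_plus base_plus odd_collapse"
proof -
  have right: "{z \<in> hawaiian_plus. 0 \<le> fst z} \<subseteq> hawaiian_earring"
    by (auto simp: hawaiian_plus_def)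
  have "continuous_on hawaiian_earring (circle_map odd_index)"
    by (rule continuous_on_circle_map[where K = 2]) (auto simp: odd_index_def elim!: oddE)
  then have cont: "continuous_on {z \<in> hawaiian_plus. 0 \<le> fst z} (circle_map odd_index)"
    using right by (rule continuous_on_subset)
  have meet: "z = circle_map odd_index z" if "z \<in> hawaiian_plus" "fst z = 0" for z
  proof -
    have "z \<in> hawaiian_earring" using that by (intro subsetD[OF right]) simp
    then have "z = (0, 0)" using that(2) by (rule earring_fst_zero)
    then show ?thesis by simp
  qed
  have "continuous_on hawaiian_plus (\<lambda>z. if fst z \<le> 0 then z else circle_map odd_index z)"
  proof (rule continuous_on_cases_le)
    show "continuous_on {z \<in> hawaiian_plus. fst z \<le> 0} (\<lambda>z. z)"
      by (rule continuous_on_id)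
    show "continuous_on hawaiian_plus fst"
      by (rule continuous_on_fst[OF continuous_on_id])
  qed (rule cont, rule meet)
  then have "continuous_on hawaiian_plus odd_collapse"
    by (simp add: odd_collapse_def[abs_def])
  moreover have "odd_collapse z \<in> hawaiian_plus" if "z \<in> hawaiian_plus" for z
    using that right circle_map_in_earring[of z]
    by (auto simp: odd_collapse_def hawaiian_plus_def)
  moreover have "odd_collapse base_plus = base_plus"
    by (simp add: odd_collapse_def base_plus_def)
  ultimately show ?thesis
    by (auto simp: based_map_def)
qed

section \<open>Loops at the end of the whisker\<close>

lemma whisker_path: "path whisker" "path_image whisker \<subseteq> hawaiian_plus"
  "pathstart whisker = base_plus" "pathfinish whisker = (0, 0)"
  unfolding path_def whisker_def
  by (auto intro!: continuous_intros simp: path_image_def hawaiian_plus_def pathstart_def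
      pathfinish_def base_plus_def)

lemma earring_loopD:
  assumes "p \<in> loops_at hawaiian_earring (0, 0)"
  shows "path p" "path_image p \<subseteq> hawaiian_plus" "pathstart p = (0, 0)" "pathfinish p = (0, 0)"
  using assms by (auto simp: loops_at_def hawaiian_plus_def)

lemma whisker_loop:
  assumes "p \<in> loops_at hawaiian_earring (0, 0)"
  shows "whisker +++ p +++ reversepath whisker \<in> loops_at hawaiian_plus base_plus"
  using earring_loopD[OF assms] whisker_path by (simp add: loops_at_def subset_path_image_join)

lemma whisker_class_in_carrier:
  "p \<in> loops_at hawaiian_earring (0, 0) \<Longrightarrow> whisker_class p \<in> carrier pi1_plus"
  by (simp add: whisker_class_def pi1_plus_def fundamental_group_def whisker_loop)

lemma difference_loop:
  assumes "p \<in> loops_at X x0" "q \<in> loops_at X x0"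
  shows "p +++ reversepath q \<in> loops_at X x0"
  using assms by (auto simp: loops_at_def subset_path_image_join)

text \<open>The reason why \<open>odd_collapse\<close> takes \<open>P\<close> to \<open>C\<close> and \<open>p_tau\<close> to \<open>c_tau\<close>: the factor whose
  image is constant can be dropped up to homotopy.\<close>

lemma odd_collapse_difference:
  assumes p: "p \<in> loops_at hawaiian_earring (0, 0)" and q: "q \<in> loops_at hawaiian_earring (0, 0)"
    and r: "r \<in> loops_at hawaiian_earring (0, 0)"
    and pr: "\<And>t. t \<in> {0..1} \<Longrightarrow> odd_collapse (p t) = r t"
    and q0: "\<And>t. t \<in> {0..1} \<Longrightarrow> odd_collapse (q t) = (0, 0)"
  shows "induced_hom hawaiian_plus odd_collapse (whisker_class (p +++ reversepath q)) = whisker_class r"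
proof -
  let ?Z = "hawaiian_plus" and ?h = odd_collapse and ?k = "linepath (0, 0) (0, 0) :: real \<Rightarrow> real \<times> real"
  have h: "continuous_on ?Z ?h" "?h ` ?Z \<subseteq> ?Z"
    using based_map_odd_collapse by (auto simp: based_map_def)
  note rD = earring_loopD[OF r]
  have 0: "path ?k" "path_image ?k \<subseteq> ?Z"
    by (simp_all add: hawaiian_plus_def)
  have w: "homotopic_paths ?Z whisker (?h \<circ> whisker)"
    using whisker_path by (intro homotopic_paths_eq) (auto simp: odd_collapse_def whisker_def)
  have w': "homotopic_paths ?Z (reversepath whisker) (?h \<circ> reversepath whisker)"
    unfolding path_compose_reversepath using w by (rule homotopic_paths_reversepath_D)
  have p': "homotopic_paths ?Z r (?h \<circ> p)"
    using rD pr by (intro homotopic_paths_eq) auto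
  have q': "homotopic_paths ?Z ?k (?h \<circ> reversepath q)"
    using 0 q0 by (intro homotopic_paths_eq) (auto simp: reversepath_def linepath_refl)
  have "homotopic_paths ?Z r (r +++ ?k)"
    using rD by (intro homotopic_paths_sym[OF homotopic_paths_rid']) auto
  moreover have "homotopic_paths ?Z (r +++ ?k) ((?h \<circ> p) +++ (?h \<circ> reversepath q))"
    using p' q' rD by (intro homotopic_paths_join) auto
  ultimately have "homotopic_paths ?Z r ((?h \<circ> p) +++ (?h \<circ> reversepath q))"
    by (rule homotopic_paths_trans)
  then have "homotopic_paths ?Z (whisker +++ r +++ reversepath whisker)
      ((?h \<circ> whisker) +++ ((?h \<circ> p) +++ (?h \<circ> reversepath q)) +++ (?h \<circ> reversepath whisker))"
    using w w' rD whisker_path by (intro homotopic_paths_join) auto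
  then have "homotopic_paths ?Z (whisker +++ r +++ reversepath whisker)
      (?h \<circ> (whisker +++ (p +++ reversepath q) +++ reversepath whisker))"
    by (simp add: path_compose_join)
  then have "path_class ?Z (whisker +++ r +++ reversepath whisker)
      = path_class ?Z (?h \<circ> (whisker +++ (p +++ reversepath q) +++ reversepath whisker))"
    using whisker_loop[OF r] by (subst path_class_eq_iff) (auto simp: loops_at_def)
  moreover have "induced_hom ?Z ?h (whisker_class (p +++ reversepath q))
      = path_class ?Z (?h \<circ> (whisker +++ (p +++ reversepath q) +++ reversepath whisker))"
    unfolding whisker_class_def using whisker_loop[OF difference_loop[OF p q]] h
    by (intro induced_hom_path_class) (auto simp: loops_at_def)
  ultimately show ?thesis
    by (simp add: whisker_class_def)
qed

lemma odd_collapse_generator: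
  assumes "n \<ge> 1"
  shows "induced_hom hawaiian_plus odd_collapse
    (whisker_class (ell (2 * n - 1) +++ reversepath (ell (2 * n)))) = whisker_class (ell n)"
  using assms by (intro odd_collapse_difference ell_loop) (auto simp: odd_collapse_ell simp del: One_nat_def)

lemma circle_map_loop:
  fixes K :: real
  assumes "\<And>n. n \<ge> 1 \<Longrightarrow> \<sigma> n = 0 \<or> real n \<le> K * real (\<sigma> n)" "p \<in> loops_at hawaiian_earring (0, 0)"
  shows "circle_map \<sigma> \<circ> p \<in> loops_at hawaiian_earring (0, 0)"
proof -
  have p: "path p" "path_image p \<subseteq> hawaiian_earring" "pathstart p = (0, 0)" "pathfinish p = (0, 0)"
    using assms(2) by (auto simp: loops_at_def)
  have "continuous_on (path_image p) (circle_map \<sigma>)"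
    using continuous_on_circle_map[of \<sigma> K] assms(1) p(2) continuous_on_subset by blast
  then have "path (circle_map \<sigma> \<circ> p)"
    by (rule path_continuous_image[OF p(1)])
  then show ?thesis
    using p circle_map_in_earring
    by (auto simp: loops_at_def path_image_compose pathstart_compose pathfinish_compose)
qed

lemma f_odd_loop: "p \<in> loops_at hawaiian_earring (0, 0) \<Longrightarrow> f_odd \<circ> p \<in> loops_at hawaiian_earring (0, 0)"
  unfolding f_odd_def by (rule circle_map_loop[where K = 1]) auto

lemma f_even_loop: "p \<in> loops_at hawaiian_earring (0, 0) \<Longrightarrow> f_even \<circ> p \<in> loops_at hawaiian_earring (0, 0)"
  unfolding f_even_def by (rule circle_map_loop[where K = 1]) auto

lemma p_tau_in_carrier: "p_tau \<in> carrier pi1_plus"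
  unfolding p_tau_def
  by (intro whisker_class_in_carrier difference_loop f_odd_loop f_even_loop ell_tau_loop)

lemma odd_collapse_p_tau: "induced_hom hawaiian_plus odd_collapse p_tau = c_tau"
  unfolding p_tau_def c_tau_def
proof (rule odd_collapse_difference)
  have "ell_tau t \<in> hawaiian_earring" if "t \<in> {0..1}" for t
    using ell_tau_loop that by (auto simp: loops_at_def path_image_def)
  then show "odd_collapse ((f_odd \<circ> ell_tau) t) = ell_tau t"
    "odd_collapse ((f_even \<circ> ell_tau) t) = (0, 0)" if "t \<in> {0..1}" for t
    using that by (simp_all add: odd_collapse_f_odd odd_collapse_f_even)
qed (intro f_odd_loop f_even_loop ell_tau_loop)+

section \<open>Comparison of the two closure properties\<close>

theorem proposition3p20:
  fixes X :: "'a::topological_space set"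
    and x0 :: 'a
    and H :: "(real \<Rightarrow> 'a) set set"
  assumes "path_connected X"
    and "x0 \<in> X"
    and "subgroup H (fundamental_group X x0)"
    and "closed_for hawaiian_plus base_plus P_subgroup p_tau X x0 H"
  shows "closed_for hawaiian_plus base_plus C_subgroup c_tau X x0 H"
  unfolding closed_for_def
proof (intro allI impI)
  fix f assume f: "based_map hawaiian_plus base_plus X x0 f"
    and fC: "induced_hom X f ` C_subgroup \<subseteq> H"
  let ?g = "f \<circ> odd_collapse"
  have g: "based_map hawaiian_plus base_plus X x0 ?g"
    using based_map_odd_collapse f by (rule based_map_compose)
  have comp: "induced_hom X ?g A = induced_hom X f (induced_hom hawaiian_plus odd_collapse A)"
    if "A \<in> carrier pi1_plus" for A
    using induced_hom_compose[OF based_map_odd_collapse f] that by (simp add: pi1_plus_def)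
  have "base_plus \<in> hawaiian_plus"
    by (simp add: base_plus_def hawaiian_plus_def)
  then interpret group_hom pi1_plus "fundamental_group X x0" "induced_hom X ?g"
    unfolding pi1_plus_def using assms(2) induced_hom_is_hom[OF g]
    by (intro group_hom.intro group_hom_axioms.intro group_fundamental_group)
  let ?S = "{whisker_class (ell (2 * n - 1) +++ reversepath (ell (2 * n))) | n. n \<ge> 1}"
  have S: "?S \<subseteq> carrier pi1_plus"
    by (auto intro!: whisker_class_in_carrier difference_loop ell_loop)
  have "induced_hom X ?g ` ?S \<subseteq> H"
  proof
    fix B assume "B \<in> induced_hom X ?g ` ?S"
    then obtain n where n: "n \<ge> 1"
      "B = induced_hom X ?g (whisker_class (ell (2 * n - 1) +++ reversepath (ell (2 * n))))"
      by blast
    have "B = induced_hom X f (whisker_class (ell n))"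
      unfolding n(2) odd_collapse_generator[OF n(1), symmetric]
      by (intro comp whisker_class_in_carrier difference_loop ell_loop)
    moreover have "whisker_class (ell n) \<in> C_subgroup"
      unfolding C_subgroup_def using n(1) by (blast intro: generate.incl)
    ultimately show "B \<in> H" using fC by blast
  qed
  then have "generate (fundamental_group X x0) (induced_hom X ?g ` ?S) \<subseteq> H"
    using assms(3) by (rule H.generate_subgroup_incl)
  then have "induced_hom X ?g ` P_subgroup \<subseteq> H"
    unfolding P_subgroup_def generate_img[OF S] .
  then have "induced_hom X ?g p_tau \<in> H"
    using assms(4) g unfolding closed_for_def by blast
  then show "induced_hom X f c_tau \<in> H"
    unfolding comp[OF p_tau_in_carrier] odd_collapse_p_tau .
qed

end
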